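(* Let $\Sigma$ be a many-sorted signature with $|\mathcal{S}_\Sigma|<\aleph_0$. Let $\mathbb{A}$ be a $\Sigma$-structure with $\max\{|\sigma^{\mathbb{A}}|:\sigma\in\mathcal{S}_\Sigma\}\ge\aleph_0$, and let $\kappa\ge\max\{|\Sigma|,\max\{|\sigma^{\mathbb{A}}|:\sigma\in\mathcal{S}_\Sigma\}\}$ be a cardinal. Then there is a $\Sigma$-structure $\mathbb{B}$ containing $\mathbb{A}$ as an elementary substructure such that $\sigma^{\mathbb{B}}=\sigma^{\mathbb{A}}$ for all $\sigma\in\mathcal{S}^{<}_{\mathbb{A}}$, $\aleph_0\le|\sigma^{\mathbb{B}}|\le\kappa$ for all $\sigma\in\mathcal{S}^{\ge}_{\mathbb{A}}$, and $|\sigma^{\mathbb{B}}|=\kappa$ for some sort $\sigma\in\mathcal{S}_\Sigma$.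
   Context: Many-sorted first-order logic: a signature $\Sigma$ has a nonempty set $\mathcal{S}_\Sigma$ of sorts, a set $\mathcal{F}_\Sigma$ of function symbols and a set $\mathcal{P}_\Sigma$ of predicate symbols (including an equality symbol for each sort), with sorted arities; $|\Sigma|=|\mathcal{S}_\Sigma|+|\mathcal{F}_\Sigma|+|\mathcal{P}_\Sigma|$. A $\Sigma$-structure interprets each sort $\sigma$ as a nonempty set $\sigma^{\mathbb{A}}$. $\mathbb{A}$ is an elementary substructure of $\mathbb{B}$ if it is a substructure and for all formulas $\varphi$ and assignments $\nu$ into $\mathbb{A}$, $(\mathbb{A},\nu)\models\varphi$ iff $(\mathbb{B},\nu)\models\varphi$. For a structure $\mathbb{A}$, $\mathcal{S}^{\ge}_{\mathbb{A}}=\{\sigma\in\mathcal{S}_\Sigma:|\sigma^{\mathbb{A}}|\ge\aleph_0\}$ and $\mathcal{S}^{<}_{\mathbb{A}}=\mathcal{S}_\Sigma\setminus\mathcal{S}^{\ge}_{\mathbb{A}}$. *)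

theory Defs
  imports Main
begin

unbundle cardinal_syntax

record ('s, 'f, 'p) signature =
  sorts :: "'s set"
  funs :: "'f set"
  preds :: "'p set"
  fun_arity :: "'f \<Rightarrow> 's list \<times> 's"
  pred_arity :: "'p \<Rightarrow> 's list"
  eq_sym :: "'s \<Rightarrow> 'p"

text \<open>
  The equality symbols are members of the set of predicate symbols and hence count towards
  the size of the signature; they are pairwise distinct because their arities differ.
\<close>

definition is_signature :: "('s, 'f, 'p) signature \<Rightarrow> bool" where
  "is_signature \<Sigma> \<longleftrightarrow>
     sorts \<Sigma> \<noteq> {} \<and>
     (\<forall>f\<in>funs \<Sigma>. set (fst (fun_arity \<Sigma> f)) \<subseteq> sorts \<Sigma> \<and> snd (fun_arity \<Sigma> f) \<in> sorts \<Sigma>) \<and>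
     (\<forall>p\<in>preds \<Sigma>. set (pred_arity \<Sigma> p) \<subseteq> sorts \<Sigma>) \<and>
     (\<forall>\<sigma>\<in>sorts \<Sigma>. eq_sym \<Sigma> \<sigma> \<in> preds \<Sigma> \<and> pred_arity \<Sigma> (eq_sym \<Sigma> \<sigma>) = [\<sigma>, \<sigma>])"

definition sig_card :: "('s, 'f, 'p) signature \<Rightarrow> ('s + 'f + 'p) rel" where
  "sig_card \<Sigma> = |sorts \<Sigma>| +c |funs \<Sigma>| +c |preds \<Sigma>|"

record ('s, 'f, 'p, 'a) struct =
  dom_of :: "'s \<Rightarrow> 'a set"
  fun_of :: "'f \<Rightarrow> 'a list \<Rightarrow> 'a"
  pred_of :: "'p \<Rightarrow> 'a list set"

definition tuples :: "('s, 'f, 'p, 'a) struct \<Rightarrow> 's list \<Rightarrow> 'a list set" where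
  "tuples \<AA> \<sigma>s = {xs. list_all2 (\<lambda>x \<sigma>. x \<in> dom_of \<AA> \<sigma>) xs \<sigma>s}"

text \<open>
  Interpretations of sorts and symbols outside the signature and values of functions on
  ill-sorted tuples are unconstrained, and no notion below depends on them.
\<close>

definition is_struct :: "('s, 'f, 'p) signature \<Rightarrow> ('s, 'f, 'p, 'a) struct \<Rightarrow> bool" where
  "is_struct \<Sigma> \<AA> \<longleftrightarrow>
     (\<forall>\<sigma>\<in>sorts \<Sigma>. dom_of \<AA> \<sigma> \<noteq> {}) \<and>
     (\<forall>f\<in>funs \<Sigma>. \<forall>xs\<in>tuples \<AA> (fst (fun_arity \<Sigma> f)).
        fun_of \<AA> f xs \<in> dom_of \<AA> (snd (fun_arity \<Sigma> f))) \<and>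
     (\<forall>p\<in>preds \<Sigma>. pred_of \<AA> p \<subseteq> tuples \<AA> (pred_arity \<Sigma> p)) \<and>
     (\<forall>\<sigma>\<in>sorts \<Sigma>. pred_of \<AA> (eq_sym \<Sigma> \<sigma>) = {[x, x] | x. x \<in> dom_of \<AA> \<sigma>})"

definition inf_sorts :: "('s, 'f, 'p) signature \<Rightarrow> ('s, 'f, 'p, 'a) struct \<Rightarrow> 's set" where
  "inf_sorts \<Sigma> \<AA> = {\<sigma> \<in> sorts \<Sigma>. natLeq \<le>o |dom_of \<AA> \<sigma>|}"

definition fin_sorts :: "('s, 'f, 'p) signature \<Rightarrow> ('s, 'f, 'p, 'a) struct \<Rightarrow> 's set" where
  "fin_sorts \<Sigma> \<AA> = sorts \<Sigma> - inf_sorts \<Sigma> \<AA>"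

text \<open>Each sort \<open>\<sigma>\<close> has the countably many variables \<open>(n, \<sigma>)\<close>.\<close>

datatype ('s, 'f) tm = Var "nat \<times> 's" | App 'f "('s, 'f) tm list"

datatype ('s, 'f, 'p) fm =
    Atom 'p "('s, 'f) tm list"
  | Neg "('s, 'f, 'p) fm"
  | Conj "('s, 'f, 'p) fm" "('s, 'f, 'p) fm"
  | Disj "('s, 'f, 'p) fm" "('s, 'f, 'p) fm"
  | Impl "('s, 'f, 'p) fm" "('s, 'f, 'p) fm"
  | Forall "nat \<times> 's" "('s, 'f, 'p) fm"
  | Exists "nat \<times> 's" "('s, 'f, 'p) fm"

inductive has_sort :: "('s, 'f, 'p) signature \<Rightarrow> ('s, 'f) tm \<Rightarrow> 's \<Rightarrow> bool"
  for \<Sigma> :: "('s, 'f, 'p) signature" where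
  "\<sigma> \<in> sorts \<Sigma> \<Longrightarrow> has_sort \<Sigma> (Var (n, \<sigma>)) \<sigma>"
| "f \<in> funs \<Sigma> \<Longrightarrow> list_all2 (has_sort \<Sigma>) ts (fst (fun_arity \<Sigma> f)) \<Longrightarrow>
     has_sort \<Sigma> (App f ts) (snd (fun_arity \<Sigma> f))"

primrec is_formula :: "('s, 'f, 'p) signature \<Rightarrow> ('s, 'f, 'p) fm \<Rightarrow> bool" where
  "is_formula \<Sigma> (Atom p ts) \<longleftrightarrow>
     p \<in> preds \<Sigma> \<and> list_all2 (has_sort \<Sigma>) ts (pred_arity \<Sigma> p)"
| "is_formula \<Sigma> (Neg \<phi>) \<longleftrightarrow> is_formula \<Sigma> \<phi>"
| "is_formula \<Sigma> (Conj \<phi> \<psi>) \<longleftrightarrow> is_formula \<Sigma> \<phi> \<and> is_formula \<Sigma> \<psi>"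
| "is_formula \<Sigma> (Disj \<phi> \<psi>) \<longleftrightarrow> is_formula \<Sigma> \<phi> \<and> is_formula \<Sigma> \<psi>"
| "is_formula \<Sigma> (Impl \<phi> \<psi>) \<longleftrightarrow> is_formula \<Sigma> \<phi> \<and> is_formula \<Sigma> \<psi>"
| "is_formula \<Sigma> (Forall v \<phi>) \<longleftrightarrow> snd v \<in> sorts \<Sigma> \<and> is_formula \<Sigma> \<phi>"
| "is_formula \<Sigma> (Exists v \<phi>) \<longleftrightarrow> snd v \<in> sorts \<Sigma> \<and> is_formula \<Sigma> \<phi>"

definition is_assignment ::
    "('s, 'f, 'p) signature \<Rightarrow> ('s, 'f, 'p, 'a) struct \<Rightarrow> (nat \<times> 's \<Rightarrow> 'a) \<Rightarrow> bool" where
  "is_assignment \<Sigma> \<AA> \<nu> \<longleftrightarrow> (\<forall>n. \<forall>\<sigma>\<in>sorts \<Sigma>. \<nu> (n, \<sigma>) \<in> dom_of \<AA> \<sigma>)"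

primrec eval_tm ::
    "('s, 'f, 'p, 'a) struct \<Rightarrow> (nat \<times> 's \<Rightarrow> 'a) \<Rightarrow> ('s, 'f) tm \<Rightarrow> 'a" where
  "eval_tm \<AA> \<nu> (Var v) = \<nu> v"
| "eval_tm \<AA> \<nu> (App f ts) = fun_of \<AA> f (map (eval_tm \<AA> \<nu>) ts)"

primrec sat ::
    "('s, 'f, 'p, 'a) struct \<Rightarrow> (nat \<times> 's \<Rightarrow> 'a) \<Rightarrow> ('s, 'f, 'p) fm \<Rightarrow> bool" where
  "sat \<AA> \<nu> (Atom p ts) \<longleftrightarrow> map (eval_tm \<AA> \<nu>) ts \<in> pred_of \<AA> p"
| "sat \<AA> \<nu> (Neg \<phi>) \<longleftrightarrow> \<not> sat \<AA> \<nu> \<phi>"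
| "sat \<AA> \<nu> (Conj \<phi> \<psi>) \<longleftrightarrow> sat \<AA> \<nu> \<phi> \<and> sat \<AA> \<nu> \<psi>"
| "sat \<AA> \<nu> (Disj \<phi> \<psi>) \<longleftrightarrow> sat \<AA> \<nu> \<phi> \<or> sat \<AA> \<nu> \<psi>"
| "sat \<AA> \<nu> (Impl \<phi> \<psi>) \<longleftrightarrow> (sat \<AA> \<nu> \<phi> \<longrightarrow> sat \<AA> \<nu> \<psi>)"
| "sat \<AA> \<nu> (Forall v \<phi>) \<longleftrightarrow> (\<forall>x\<in>dom_of \<AA> (snd v). sat \<AA> (\<nu>(v := x)) \<phi>)"
| "sat \<AA> \<nu> (Exists v \<phi>) \<longleftrightarrow> (\<exists>x\<in>dom_of \<AA> (snd v). sat \<AA> (\<nu>(v := x)) \<phi>)"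

definition substruct ::
    "('s, 'f, 'p) signature \<Rightarrow> ('s, 'f, 'p, 'a) struct \<Rightarrow> ('s, 'f, 'p, 'a) struct \<Rightarrow> bool" where
  "substruct \<Sigma> \<AA> \<BB> \<longleftrightarrow>
     is_struct \<Sigma> \<AA> \<and> is_struct \<Sigma> \<BB> \<and>
     (\<forall>\<sigma>\<in>sorts \<Sigma>. dom_of \<AA> \<sigma> \<subseteq> dom_of \<BB> \<sigma>) \<and>
     (\<forall>f\<in>funs \<Sigma>. \<forall>xs\<in>tuples \<AA> (fst (fun_arity \<Sigma> f)). fun_of \<AA> f xs = fun_of \<BB> f xs) \<and>
     (\<forall>p\<in>preds \<Sigma>. pred_of \<AA> p = pred_of \<BB> p \<inter> tuples \<AA> (pred_arity \<Sigma> p))"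

definition elementary_substruct ::
    "('s, 'f, 'p) signature \<Rightarrow> ('s, 'f, 'p, 'a) struct \<Rightarrow> ('s, 'f, 'p, 'a) struct \<Rightarrow> bool" where
  "elementary_substruct \<Sigma> \<AA> \<BB> \<longleftrightarrow>
     substruct \<Sigma> \<AA> \<BB> \<and>
     (\<forall>\<phi> \<nu>. is_formula \<Sigma> \<phi> \<longrightarrow> is_assignment \<Sigma> \<AA> \<nu> \<longrightarrow> (sat \<AA> \<nu> \<phi> \<longleftrightarrow> sat \<BB> \<nu> \<phi>))"

text \<open>
  A type need not contain enough elements outside a given structure to hold a proper extension
  of it.  The following isomorphic copy of a structure along an injection (only used for
  injective \<open>h\<close>) moves it into a larger type, where extensions can be formed by literal inclusion.
\<close>

definition image_struct ::
    "('a \<Rightarrow> 'b) \<Rightarrow> ('s, 'f, 'p, 'a) struct \<Rightarrow> ('s, 'f, 'p, 'b) struct" where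
  "image_struct h \<AA> =
     \<lparr>dom_of = (\<lambda>\<sigma>. h ` dom_of \<AA> \<sigma>),
      fun_of = (\<lambda>f ys. h (fun_of \<AA> f (map (inv h) ys))),
      pred_of = (\<lambda>p. map h ` pred_of \<AA> p)\<rparr>"

lemma dom_of_image_struct [simp]: "dom_of (image_struct h \<AA>) \<sigma> = h ` dom_of \<AA> \<sigma>"
  and pred_of_image_struct [simp]: "pred_of (image_struct h \<AA>) p = map h ` pred_of \<AA> p"
  and fun_of_image_struct: "inj h \<Longrightarrow> fun_of (image_struct h \<AA>) f (map h xs) = h (fun_of \<AA> f xs)"
  by (simp_all add: image_struct_def)

lemma tuples_image_struct:
  "tuples (image_struct h \<AA>) \<sigma>s = map h ` tuples \<AA> \<sigma>s"
proof
  show "map h ` tuples \<AA> \<sigma>s \<subseteq> tuples (image_struct h \<AA>) \<sigma>s"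
    by (auto simp: tuples_def list_all2_conv_all_nth)
  show "tuples (image_struct h \<AA>) \<sigma>s \<subseteq> map h ` tuples \<AA> \<sigma>s"
  proof
    fix ys assume "ys \<in> tuples (image_struct h \<AA>) \<sigma>s"
    then have len: "length ys = length \<sigma>s"
      and "\<forall>i<length \<sigma>s. \<exists>x. x \<in> dom_of \<AA> (\<sigma>s ! i) \<and> ys ! i = h x"
      by (auto simp: tuples_def list_all2_conv_all_nth)
    then obtain g where g: "g i \<in> dom_of \<AA> (\<sigma>s ! i)" "ys ! i = h (g i)"
      if "i < length \<sigma>s" for i
      by metis
    have "ys = map h (map g [0..<length \<sigma>s])"
      by (rule nth_equalityI) (simp_all only: len g length_map length_upt nth_map nth_upt minus_nat.diff_0 add_0)
    moreover have "map g [0..<length \<sigma>s] \<in> tuples \<AA> \<sigma>s"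
      using g by (simp add: tuples_def list_all2_conv_all_nth)
    ultimately show "ys \<in> map h ` tuples \<AA> \<sigma>s"
      by (rule image_eqI)
  qed
qed

lemma is_struct_image_struct:
  assumes h: "inj h" and \<AA>: "is_struct \<Sigma> \<AA>"
  shows "is_struct \<Sigma> (image_struct h \<AA>)"
  unfolding is_struct_def
proof (intro conjI ballI)
  fix \<sigma> assume \<sigma>: "\<sigma> \<in> sorts \<Sigma>"
  then show "dom_of (image_struct h \<AA>) \<sigma> \<noteq> {}"
    using \<AA> by (simp add: is_struct_def)
  have "pred_of \<AA> (eq_sym \<Sigma> \<sigma>) = (\<lambda>x. [x, x]) ` dom_of \<AA> \<sigma>"
    using \<AA> \<sigma> unfolding is_struct_def by blast
  then have "pred_of (image_struct h \<AA>) (eq_sym \<Sigma> \<sigma>) = (\<lambda>y. [y, y]) ` h ` dom_of \<AA> \<sigma>"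
    by (simp add: image_image)
  then show "pred_of (image_struct h \<AA>) (eq_sym \<Sigma> \<sigma>)
      = {[y, y] | y. y \<in> dom_of (image_struct h \<AA>) \<sigma>}"
    unfolding dom_of_image_struct by blast
next
  fix f ys
  assume f: "f \<in> funs \<Sigma>" and "ys \<in> tuples (image_struct h \<AA>) (fst (fun_arity \<Sigma> f))"
  then obtain xs where xs: "xs \<in> tuples \<AA> (fst (fun_arity \<Sigma> f))" "ys = map h xs"
    unfolding tuples_image_struct by blast
  with f \<AA> have "fun_of \<AA> f xs \<in> dom_of \<AA> (snd (fun_arity \<Sigma> f))"
    unfolding is_struct_def by blast
  then show "fun_of (image_struct h \<AA>) f ys
      \<in> dom_of (image_struct h \<AA>) (snd (fun_arity \<Sigma> f))"
    unfolding xs(2) fun_of_image_struct[OF h] dom_of_image_struct by (rule imageI)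
next
  fix p assume "p \<in> preds \<Sigma>"
  with \<AA> have "pred_of \<AA> p \<subseteq> tuples \<AA> (pred_arity \<Sigma> p)"
    unfolding is_struct_def by blast
  then show "pred_of (image_struct h \<AA>) p \<subseteq> tuples (image_struct h \<AA>) (pred_arity \<Sigma> p)"
    unfolding tuples_image_struct pred_of_image_struct by (rule image_mono)
qed

lemma eval_tm_image_struct:
  assumes "inj h"
  shows "eval_tm (image_struct h \<AA>) (\<lambda>v. h (\<nu> v)) t = h (eval_tm \<AA> \<nu> t)"
proof (induction t)
  case (App f ts)
  then have "map (eval_tm (image_struct h \<AA>) (\<lambda>v. h (\<nu> v))) ts = map h (map (eval_tm \<AA> \<nu>) ts)"
    by simp
  then show ?case
    by (simp only: eval_tm.simps fun_of_image_struct[OF assms])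
qed simp

lemma sat_image_struct:
  assumes "inj h"
  shows "sat (image_struct h \<AA>) (\<lambda>v. h (\<nu> v)) \<phi> \<longleftrightarrow> sat \<AA> \<nu> \<phi>"
proof (induction \<phi> arbitrary: \<nu>)
  case (Atom p ts)
  have "map (eval_tm (image_struct h \<AA>) (\<lambda>v. h (\<nu> v))) ts = map h (map (eval_tm \<AA> \<nu>) ts)"
    using assms by (simp add: eval_tm_image_struct)
  moreover have "inj (map h)"
    using assms by (simp add: inj_mapI)
  ultimately show ?case
    by (simp only: sat.simps pred_of_image_struct inj_image_mem_iff)
next
  case (Forall v \<phi>)
  have "(\<lambda>v. h (\<nu> v))(v := h x) = (\<lambda>u. h ((\<nu>(v := x)) u))" for x by auto
  then show ?case by (simp only: sat.simps dom_of_image_struct ball_simps Forall)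
next
  case (Exists v \<phi>)
  have "(\<lambda>v. h (\<nu> v))(v := h x) = (\<lambda>u. h ((\<nu>(v := x)) u))" for x by auto
  then show ?case by (simp only: sat.simps dom_of_image_struct bex_simps Exists)
qed simp_all

end

theory Submission
  imports Defs
begin

text \<open>
  An ultrapower and a downward Skolem hull are taken in a single step.  Let \<open>U\<close> be an
  ultrafilter on the finite subsets \<open>J\<close> of \<open>\<kappa>\<close> containing every set of the form
  \<open>{J. k \<in> J}\<close>.  Fix an infinite sort and, for each \<open>J\<close>, a map from \<open>\<kappa>\<close> into it that
  is injective on \<open>J\<close>; this yields \<open>\<kappa>\<close> functions of \<open>J\<close> that are pairwise distinct modulo
  \<open>U\<close>.  Close these functions and the constant ones under the function symbols and under
  pointwise Skolem functions.  There are at most \<open>\<kappa>\<close> formulas, so the closure \<open>H\<close> has size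
  at most \<open>\<kappa>\<close>, and Los's theorem holds for \<open>H\<close> modulo \<open>U\<close> because \<open>H\<close> contains all
  the witnesses that its proof needs.  Finite sorts do not grow, since a function with finitely
  many values is constant modulo \<open>U\<close>.  Sorts may overlap, so \<open>H\<close> is left unsorted and the
  elements of sort \<open>\<sigma>\<close> are the classes of those members of \<open>H\<close> with all values in \<open>\<sigma>\<close>.
\<close>

section \<open>Ultrafilters\<close>

text \<open>Filters in HOL include the improper one, \<open>bot\<close>, in which every predicate
  holds eventually; an ultrafilter has to exclude it.\<close>

definition ultra :: "'i filter \<Rightarrow> bool" where
  "ultra U \<longleftrightarrow> U \<noteq> bot \<and> (\<forall>P. eventually P U \<or> eventually (\<lambda>i. \<not> P i) U)"

lemma ultra_not_eventually:
  assumes "ultra U"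
  shows "\<not> eventually P U \<longleftrightarrow> eventually (\<lambda>i. \<not> P i) U"
proof
  show "eventually (\<lambda>i. \<not> P i) U" if "\<not> eventually P U"
    using assms that unfolding ultra_def by blast
  show "\<not> eventually P U" if "eventually (\<lambda>i. \<not> P i) U"
  proof
    assume "eventually P U"
    with that have "eventually (\<lambda>_. False) U" by eventually_elim simp
    with assms show False by (simp add: ultra_def trivial_limit_def)
  qed
qed

text \<open>Negation commutes with \<open>eventually\<close> for an ultrafilter, so the conjunction
  rule, valid in every filter, dualises.\<close>

lemma ultra_eventually_disj:
  assumes "ultra U"
  shows "eventually (\<lambda>i. P i \<or> Q i) U \<longleftrightarrow> eventually P U \<or> eventually Q U"
proof -
  have "\<not> eventually (\<lambda>i. P i \<or> Q i) U \<longleftrightarrow> \<not> eventually P U \<and> \<not> eventually Q U"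
    unfolding ultra_not_eventually[OF assms] by (simp add: eventually_conj_iff)
  then show ?thesis by blast
qed

text \<open>Splitting off one element of \<open>D\<close> at a time reduces this to the disjunction
  rule; an empty \<open>D\<close> would make \<open>U\<close> improper.\<close>

lemma ultra_eventually_finite:
  assumes "ultra U" "finite D" "eventually (\<lambda>i. g i \<in> D) U"
  obtains a where "a \<in> D" "eventually (\<lambda>i. g i = a) U"
proof -
  have "\<exists>a\<in>D. eventually (\<lambda>i. g i = a) U"
    using assms(2,3)
  proof (induction D)
    case empty
    then show ?case using assms(1) by (simp add: ultra_def trivial_limit_def)
  next
    case (insert a D)
    then show ?case using ultra_eventually_disj[OF assms(1)] by auto
  qed
  then show thesis using that by blast
qed

text \<open>Finer filters are smaller in the order of HOL, so Zorn's lemma is applied with the order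
  reversed and yields a minimal proper filter below \<open>F\<close>.\<close>

lemma ultra_exists:
  fixes F :: "'i filter"
  assumes "F \<noteq> bot"
  obtains U where "ultra U" "U \<le> F"
proof -
  let ?A = "{G. G \<noteq> bot \<and> G \<le> F}"
  have "\<exists>U\<in>?A. \<forall>G\<in>?A. G \<le> U \<longrightarrow> G = U"
  proof (rule predicate_Zorn[of ?A "\<lambda>x y. y \<le> x"])
    show "partial_order_on ?A (relation_of (\<lambda>x y. y \<le> x) ?A)"
      by (rule partial_order_on_relation_ofI) auto
  next
    fix C assume "C \<in> Chains (relation_of (\<lambda>x y. y \<le> x) ?A)"
    then have C: "C \<subseteq> ?A" and chain: "\<And>G G'. G \<in> C \<Longrightarrow> G' \<in> C \<Longrightarrow> G \<le> G' \<or> G' \<le> G"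
      unfolding Chains_def relation_of_def by auto
    show "\<exists>u\<in>?A. \<forall>G\<in>C. u \<le> G"
    proof (cases "C = {}")
      case True
      then show ?thesis using assms by auto
    next
      case False
      \<comment> \<open>A chain is directed downwards, so whatever holds eventually in
        \<open>Inf C\<close> does so already in some member. Hence \<open>Inf C\<close> is proper
        because all members are.\<close>
      have "\<exists>x\<in>C. x \<le> inf G G'" if "G \<in> C" "G' \<in> C" for G G'
        using chain[OF that] that by auto
      from eventually_Inf_base[OF False this]
      have "eventually P (Inf C) \<longleftrightarrow> (\<exists>b\<in>C. eventually P b)" for P .
      then have "Inf C \<noteq> bot"
        using C by (auto simp: trivial_limit_def)
      moreover have "Inf C \<le> F"
        using C False by (auto intro: Inf_lower2)
      ultimately show ?thesis by (auto intro: Inf_lower)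
    qed
  qed
  then obtain U where U: "U \<noteq> bot" "U \<le> F"
    and max: "\<And>G. G \<noteq> bot \<Longrightarrow> G \<le> F \<Longrightarrow> G \<le> U \<Longrightarrow> G = U" by auto
  \<comment> \<open>If the negation of \<open>P\<close> is not in \<open>U\<close>, then adjoining
    \<open>P\<close> leaves the filter proper, and minimality shows that \<open>P\<close> was in
    \<open>U\<close> already.\<close>
  have "eventually P U" if "\<not> eventually (\<lambda>i. \<not> P i) U" for P
  proof -
    let ?G = "inf U (principal {i. P i})"
    have ev: "eventually Q ?G \<longleftrightarrow> eventually (\<lambda>i. P i \<longrightarrow> Q i) U" for Q
      by (simp add: eventually_inf_principal)
    have "?G \<noteq> bot" using that ev[of "\<lambda>_. False"] by (simp add: trivial_limit_def)
    then have "?G = U" using U(2) by (intro max) (auto intro: le_infI1)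
    then show ?thesis using ev[of P] by simp
  qed
  then have "ultra U" using U(1) unfolding ultra_def by blast
  with U(2) show thesis using that by blast
qed

section \<open>Cardinality of closures under finitary operations\<close>

text \<open>Operations take lists of every length, so no arities are tracked. Values at lists of
  unintended length only add members, and the cardinality bound covers these too.\<close>

inductive_set op_closure :: "('x list \<Rightarrow> 'x) set \<Rightarrow> 'x set \<Rightarrow> 'x set"
  for F :: "('x list \<Rightarrow> 'x) set" and G :: "'x set" where
  base: "x \<in> G \<Longrightarrow> x \<in> op_closure F G"
| op: "f \<in> F \<Longrightarrow> \<forall>x\<in>set xs. x \<in> op_closure F G \<Longrightarrow> f xs \<in> op_closure F G"

lemma card_of_image_ordLeq: "|A| \<le>o r \<Longrightarrow> |f ` A| \<le>o r"
  using card_of_image ordLeq_transitive by blast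

lemma card_of_subset_ordLeq: "A \<subseteq> B \<Longrightarrow> |B| \<le>o r \<Longrightarrow> |A| \<le>o r"
  using card_of_mono1 ordLeq_transitive by blast

context
  fixes r :: "'k rel"
  assumes r: "Card_order r" and inf: "infinite (Field r)"
begin

lemma card_of_nat_ordLeq: "|N :: nat set| \<le>o r"
proof -
  have "|UNIV :: nat set| \<le>o |Field r|"
    using inf infinite_iff_card_of_nat by blast
  then have "|UNIV :: nat set| \<le>o r"
    using card_of_Field_ordIso[OF r] ordLeq_ordIso_trans by blast
  then show ?thesis by (rule card_of_subset_ordLeq[OF subset_UNIV])
qed

lemma card_of_finite_ordLeq: "finite A \<Longrightarrow> |A| \<le>o r"
  using card_of_Field_ordIso[OF r] inf
  by (meson card_of_Well_order card_of_ordLeq_finite ordLeq_ordIso_trans ordLeq_total)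

text \<open>The lists of length \<open>n\<close> are bounded by induction on \<open>n\<close>
  through iterated products with \<open>A\<close>; all lists form a countable union of these
  sets.\<close>

lemma card_of_lists_ordLeq:
  assumes "|A| \<le>o r"
  shows "|lists A| \<le>o r"
proof -
  have "|{xs \<in> lists A. length xs = n}| \<le>o r" for n
  proof (induction n)
    case 0
    have "{xs \<in> lists A. length xs = 0} = {[]}" by auto
    then show ?case by (simp add: card_of_finite_ordLeq)
  next
    case (Suc n)
    have sub: "{xs \<in> lists A. length xs = Suc n}
        \<subseteq> (\<lambda>(x, xs). x # xs) ` (A \<times> {xs \<in> lists A. length xs = n})"
      by (auto simp: length_Suc_conv image_iff)
    have "|A \<times> {xs \<in> lists A. length xs = n}| \<le>o r"
      by (rule card_of_Times_ordLeq_infinite_Field[OF inf assms Suc r])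
    then show ?case
      by (rule card_of_subset_ordLeq[OF sub card_of_image_ordLeq])
  qed
  then have "|\<Union>n\<in>UNIV. {xs \<in> lists A. length xs = n}| \<le>o r"
    by (intro card_of_UNION_ordLeq_infinite_Field inf r card_of_nat_ordLeq) blast
  moreover have "lists A \<subseteq> (\<Union>n\<in>UNIV. {xs \<in> lists A. length xs = n})" by auto
  ultimately show ?thesis using card_of_subset_ordLeq by blast
qed

text \<open>The closure is exhausted by countably many stages \<open>S n\<close>, each of which adds
  the values of all operations at lists over the preceding stage.\<close>

lemma card_of_op_closure_ordLeq:
  assumes F: "|F| \<le>o r" and G: "|G| \<le>o r"
  shows "|op_closure F G| \<le>o r"
proof -
  define S where "S = rec_nat G (\<lambda>_ X. X \<union> (\<Union>f\<in>F. f ` lists X))"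
  have S_Suc: "S (Suc n) = S n \<union> (\<Union>f\<in>F. f ` lists (S n))" for n
    by (simp add: S_def)
  have "|S n| \<le>o r" for n
  proof (induction n)
    case 0
    then show ?case by (simp add: S_def G)
  next
    case (Suc n)
    have "|\<Union>f\<in>F. f ` lists (S n)| \<le>o r"
      using Suc by (intro card_of_UNION_ordLeq_infinite_Field inf r F ballI
          card_of_image_ordLeq card_of_lists_ordLeq)
    then show ?case
      unfolding S_Suc using card_of_Un_ordLeq_infinite_Field[OF inf Suc _ r] by blast
  qed
  then have card: "|\<Union>n\<in>UNIV. S n| \<le>o r"
    by (intro card_of_UNION_ordLeq_infinite_Field inf r card_of_nat_ordLeq) blast
  have mono: "S m \<subseteq> S n" if "m \<le> n" for m n
    by (rule lift_Suc_mono_le[of S, OF _ that]) (simp add: S_Suc)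
  have "\<exists>n. x \<in> S n" if "x \<in> op_closure F G" for x
    using that
  proof induction
    case (base x)
    then have "x \<in> S 0" by (simp add: S_def)
    then show ?case ..
  next
    case (op f xs)
    then have "\<forall>x\<in>set xs. \<exists>n. x \<in> S n" by blast
    from bchoice[OF this] obtain n where n: "\<forall>x\<in>set xs. x \<in> S (n x)" ..
    \<comment> \<open>Finitely many arguments all lie in the latest of their stages. For empty
      \<open>xs\<close> the maximum is unspecified, but the claim is then vacuous.\<close>
    have "x \<in> S (Max (n ` set xs))" if "x \<in> set xs" for x
      using n mono[of "n x" "Max (n ` set xs)"] that by auto
    then have "xs \<in> lists (S (Max (n ` set xs)))" by blast
    then have "f xs \<in> S (Suc (Max (n ` set xs)))"
      using op.hyps(1) unfolding S_Suc by blast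
    then show ?case ..
  qed
  then have "op_closure F G \<subseteq> (\<Union>n\<in>UNIV. S n)" by blast
  then show ?thesis using card by (rule card_of_subset_ordLeq)
qed

end

section \<open>Variables and the number of formulas\<close>

primrec vars_tm :: "('s, 'f) tm \<Rightarrow> (nat \<times> 's) set" where
  "vars_tm (Var v) = {v}"
| "vars_tm (App f ts) = \<Union> (set (map vars_tm ts))"

text \<open>Bound variables are collected as well: any finite set containing the free variables
  serves the purpose, and this one avoids cases about shadowing.\<close>

primrec vars_fm :: "('s, 'f, 'p) fm \<Rightarrow> (nat \<times> 's) set" where
  "vars_fm (Atom p ts) = \<Union> (vars_tm ` set ts)"
| "vars_fm (Neg \<phi>) = vars_fm \<phi>"
| "vars_fm (Conj \<phi> \<psi>) = vars_fm \<phi> \<union> vars_fm \<psi>"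
| "vars_fm (Disj \<phi> \<psi>) = vars_fm \<phi> \<union> vars_fm \<psi>"
| "vars_fm (Impl \<phi> \<psi>) = vars_fm \<phi> \<union> vars_fm \<psi>"
| "vars_fm (Forall v \<phi>) = insert v (vars_fm \<phi>)"
| "vars_fm (Exists v \<phi>) = insert v (vars_fm \<phi>)"

lemma finite_vars_tm: "finite (vars_tm t)"
  by (induction t) auto

lemma finite_vars_fm: "finite (vars_fm \<phi>)"
  by (induction \<phi>) (auto simp: finite_vars_tm)

lemma has_sort_vars_tm: "has_sort \<Sigma> t \<sigma> \<Longrightarrow> v \<in> vars_tm t \<Longrightarrow> snd v \<in> sorts \<Sigma>"
proof (induction rule: has_sort.induct)
  case (2 f ts)
  then show ?case by (auto simp: list_all2_conv_all_nth in_set_conv_nth)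
qed auto

lemma is_formula_vars_fm: "is_formula \<Sigma> \<phi> \<Longrightarrow> v \<in> vars_fm \<phi> \<Longrightarrow> snd v \<in> sorts \<Sigma>"
proof (induction \<phi>)
  case (Atom p ts)
  then obtain t where t: "t \<in> set ts" "v \<in> vars_tm t" by auto
  with Atom obtain \<sigma> where "has_sort \<Sigma> t \<sigma>"
    by (auto simp: list_all2_conv_all_nth in_set_conv_nth)
  then show ?case using t(2) by (rule has_sort_vars_tm)
qed auto

lemma eval_tm_cong:
  "(\<And>v. v \<in> vars_tm t \<Longrightarrow> \<nu> v = \<nu>' v) \<Longrightarrow> eval_tm \<AA> \<nu> t = eval_tm \<AA> \<nu>' t"
proof (induction t)
  case (App f ts)
  then have "map (eval_tm \<AA> \<nu>) ts = map (eval_tm \<AA> \<nu>') ts" by auto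
  then show ?case by (simp only: eval_tm.simps)
qed simp

lemma sat_cong:
  "(\<And>v. v \<in> vars_fm \<phi> \<Longrightarrow> \<nu> v = \<nu>' v) \<Longrightarrow> sat \<AA> \<nu> \<phi> = sat \<AA> \<nu>' \<phi>"
proof (induction \<phi> arbitrary: \<nu> \<nu>')
  case (Atom p ts)
  have "map (eval_tm \<AA> \<nu>) ts = map (eval_tm \<AA> \<nu>') ts"
    by (rule map_cong[OF refl], rule eval_tm_cong, rule Atom) auto
  then show ?case by (simp only: sat.simps)
next
  case (Neg \<phi>)
  from Neg.IH[of \<nu> \<nu>'] Neg.prems show ?case by simp
next
  case (Conj \<phi> \<psi>)
  from Conj.IH[of \<nu> \<nu>'] Conj.prems show ?case by simp
next
  case (Disj \<phi> \<psi>)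
  from Disj.IH[of \<nu> \<nu>'] Disj.prems show ?case by simp
next
  case (Impl \<phi> \<psi>)
  from Impl.IH[of \<nu> \<nu>'] Impl.prems show ?case by simp
next
  case (Forall v \<phi>)
  then have "sat \<AA> (\<nu>(v := x)) \<phi> = sat \<AA> (\<nu>'(v := x)) \<phi>" for x
    by (intro Forall.IH) auto
  then show ?case by simp
next
  case (Exists v \<phi>)
  then have "sat \<AA> (\<nu>(v := x)) \<phi> = sat \<AA> (\<nu>'(v := x)) \<phi>" for x
    by (intro Exists.IH) auto
  then show ?case by simp
qed

section \<open>Counting terms and formulas over the signature\<close>

context
  fixes r :: "'k rel" and \<Sigma> :: "('s, 'f, 'p) signature"
  assumes r: "Card_order r" and inf: "infinite (Field r)"
    and sorts: "|sorts \<Sigma>| \<le>o r" and funs: "|funs \<Sigma>| \<le>o r" and preds: "|preds \<Sigma>| \<le>o r"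
begin

lemma card_of_variables_ordLeq: "|(UNIV :: nat set) \<times> sorts \<Sigma>| \<le>o r"
  using card_of_Times_ordLeq_infinite_Field[OF inf card_of_nat_ordLeq[OF r inf] sorts r] .

text \<open>Well-sorted terms lie in the closure of the variables under the operations
  \<open>App f\<close>; this closure also contains ill-sorted terms but is still small.\<close>

lemma card_of_terms_ordLeq: "|{t. \<exists>\<sigma>. has_sort \<Sigma> t \<sigma>}| \<le>o r"
proof -
  let ?C = "op_closure (App ` funs \<Sigma>) (Var ` (UNIV \<times> sorts \<Sigma>))"
  have C: "t \<in> ?C" if "has_sort \<Sigma> t \<sigma>" for t \<sigma>
    using that
  proof (induction rule: has_sort.induct)
    case (1 \<sigma> n)
    then show ?case by (auto intro: op_closure.base)
  next
    case (2 f ts)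
    then have "\<forall>t\<in>set ts. t \<in> ?C"
      by (auto simp: list_all2_conv_all_nth in_set_conv_nth)
    with 2 show ?case by (intro op_closure.op) auto
  qed
  have "|?C| \<le>o r"
    by (intro card_of_op_closure_ordLeq r inf card_of_image_ordLeq funs card_of_variables_ordLeq)
  then show ?thesis
    by (rule card_of_subset_ordLeq[rotated]) (use C in blast)
qed

lemma card_of_formulas_ordLeq: "|{\<phi>. is_formula \<Sigma> \<phi>}| \<le>o r"
proof -
  define G where
    "G = (\<lambda>(p, ts). Atom p ts) ` (preds \<Sigma> \<times> lists {t. \<exists>\<sigma>. has_sort \<Sigma> t \<sigma>})"
  \<comment> \<open>Connectives read the first entries of their argument list. Each quantifier
    contributes one operation for every variable, hence at most \<open>r\<close> many.\<close>
  define F :: "(('s, 'f, 'p) fm list \<Rightarrow> ('s, 'f, 'p) fm) set" where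
    "F = {\<lambda>xs. Neg (xs ! 0), \<lambda>xs. Conj (xs ! 0) (xs ! 1), \<lambda>xs. Disj (xs ! 0) (xs ! 1),
          \<lambda>xs. Impl (xs ! 0) (xs ! 1)}
       \<union> ((\<lambda>v xs. Forall v (xs ! 0)) ` (UNIV \<times> sorts \<Sigma>)
       \<union> (\<lambda>v xs. Exists v (xs ! 0)) ` (UNIV \<times> sorts \<Sigma>))"
  have step: "f xs \<in> op_closure F G" if "f \<in> F" "set xs \<subseteq> op_closure F G" for f xs
    using that by (intro op_closure.op) auto
  have closure: "\<phi> \<in> op_closure F G" if "is_formula \<Sigma> \<phi>" for \<phi>
    using that
  proof (induction \<phi>)
    case (Atom p ts)
    then have "(p, ts) \<in> preds \<Sigma> \<times> lists {t. \<exists>\<sigma>. has_sort \<Sigma> t \<sigma>}"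
      by (fastforce simp: list_all2_conv_all_nth in_set_conv_nth)
    then have "Atom p ts \<in> G" unfolding G_def by (rule rev_image_eqI) simp
    then show ?case by (rule op_closure.base)
  next
    case (Neg \<phi>)
    then show ?case using step[of "\<lambda>xs. Neg (xs ! 0)" "[\<phi>]"] by (simp add: F_def)
  next
    case (Conj \<phi> \<psi>)
    then show ?case using step[of "\<lambda>xs. Conj (xs ! 0) (xs ! 1)" "[\<phi>, \<psi>]"] by (simp add: F_def)
  next
    case (Disj \<phi> \<psi>)
    then show ?case using step[of "\<lambda>xs. Disj (xs ! 0) (xs ! 1)" "[\<phi>, \<psi>]"] by (simp add: F_def)
  next
    case (Impl \<phi> \<psi>)
    then show ?case using step[of "\<lambda>xs. Impl (xs ! 0) (xs ! 1)" "[\<phi>, \<psi>]"] by (simp add: F_def)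
  next
    case (Forall v \<phi>)
    then have "(\<lambda>xs. Forall v (xs ! 0)) \<in> F" by (cases v) (auto simp: F_def)
    then show ?case using step[of "\<lambda>xs. Forall v (xs ! 0)" "[\<phi>]"] Forall by simp
  next
    case (Exists v \<phi>)
    then have "(\<lambda>xs. Exists v (xs ! 0)) \<in> F" by (cases v) (auto simp: F_def)
    then show ?case using step[of "\<lambda>xs. Exists v (xs ! 0)" "[\<phi>]"] Exists by simp
  qed
  have "|op_closure F G| \<le>o r"
  proof (intro card_of_op_closure_ordLeq r inf)
    show "|F| \<le>o r"
      unfolding F_def
      by (intro card_of_Un_ordLeq_infinite_Field card_of_finite_ordLeq r inf
          card_of_image_ordLeq card_of_variables_ordLeq) simp
    show "|G| \<le>o r"
      unfolding G_def
      by (intro card_of_image_ordLeq card_of_Times_ordLeq_infinite_Field inf r preds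
          card_of_lists_ordLeq card_of_terms_ordLeq)
  qed
  then show ?thesis
    by (rule card_of_subset_ordLeq[rotated]) (use closure in blast)
qed

end

section \<open>Skolem-closed subsets of an ultrapower\<close>

text \<open>Membership in the sort stands outside the implication, so that the chosen value is
  well-sorted even where no witness exists.\<close>

definition skolem ::
    "('s, 'f, 'p, 'a) struct \<Rightarrow> ('s, 'f, 'p) fm \<Rightarrow> nat \<times> 's \<Rightarrow> (nat \<times> 's \<Rightarrow> 'a) \<Rightarrow> 'a" where
  "skolem \<AA> \<phi> v \<nu> = (SOME x. x \<in> dom_of \<AA> (snd v) \<and>
     ((\<exists>y\<in>dom_of \<AA> (snd v). sat \<AA> (\<nu>(v := y)) \<phi>) \<longrightarrow> sat \<AA> (\<nu>(v := x)) \<phi>))"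

lemma skolem:
  assumes "dom_of \<AA> (snd v) \<noteq> {}"
  shows "skolem \<AA> \<phi> v \<nu> \<in> dom_of \<AA> (snd v)"
    and "y \<in> dom_of \<AA> (snd v) \<Longrightarrow> sat \<AA> (\<nu>(v := y)) \<phi> \<Longrightarrow>
      sat \<AA> (\<nu>(v := skolem \<AA> \<phi> v \<nu>)) \<phi>"
proof -
  have "\<exists>x. x \<in> dom_of \<AA> (snd v) \<and>
     ((\<exists>y\<in>dom_of \<AA> (snd v). sat \<AA> (\<nu>(v := y)) \<phi>) \<longrightarrow> sat \<AA> (\<nu>(v := x)) \<phi>)"
    using assms by blast
  from someI_ex[OF this, folded skolem_def]
  show "skolem \<AA> \<phi> v \<nu> \<in> dom_of \<AA> (snd v)"
    and "y \<in> dom_of \<AA> (snd v) \<Longrightarrow> sat \<AA> (\<nu>(v := y)) \<phi> \<Longrightarrow>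
      sat \<AA> (\<nu>(v := skolem \<AA> \<phi> v \<nu>)) \<phi>"
    by blast+
qed

text \<open>The choice depends on the assignment only through the truth of \<open>\<phi>\<close>, so
  the Skolem function is in effect a finitary operation.\<close>

lemma skolem_cong:
  assumes "\<And>u. u \<in> vars_fm \<phi> \<Longrightarrow> \<nu> u = \<nu>' u"
  shows "skolem \<AA> \<phi> v \<nu> = skolem \<AA> \<phi> v \<nu>'"
proof -
  have "sat \<AA> (\<nu>(v := x)) \<phi> = sat \<AA> (\<nu>'(v := x)) \<phi>" for x
    by (rule sat_cong) (simp add: assms)
  then show ?thesis by (simp add: skolem_def)
qed

text \<open>The map \<open>j\<close> realises the quotient of \<open>H\<close> modulo \<open>U\<close> inside a given type.\<close>

locale ultrapower_hull =
  fixes \<Sigma> :: "('s, 'f, 'p) signature"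
    and \<AA> :: "('s, 'f, 'p, 'a) struct"
    and U :: "'i filter"
    and H :: "('i \<Rightarrow> 'a) set"
    and j :: "('i \<Rightarrow> 'a) \<Rightarrow> 'b"
    and emb :: "'a \<Rightarrow> 'b"
  assumes sig: "is_signature \<Sigma>"
    and struct: "is_struct \<Sigma> \<AA>"
    and ultra: "ultra U"
    and H_const: "\<sigma> \<in> sorts \<Sigma> \<Longrightarrow> a \<in> dom_of \<AA> \<sigma> \<Longrightarrow> (\<lambda>_. a) \<in> H"
    and H_fun: "f \<in> funs \<Sigma> \<Longrightarrow> set gs \<subseteq> H \<Longrightarrow> (\<lambda>i. fun_of \<AA> f (map (\<lambda>g. g i) gs)) \<in> H"
    and H_skolem: "is_formula \<Sigma> \<phi> \<Longrightarrow> snd v \<in> sorts \<Sigma> \<Longrightarrow>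
      (\<And>u. u \<in> vars_fm \<phi> \<Longrightarrow> \<nu> u \<in> H) \<Longrightarrow> (\<lambda>i. skolem \<AA> \<phi> v (\<lambda>u. \<nu> u i)) \<in> H"
    and j_eq: "g \<in> H \<Longrightarrow> h \<in> H \<Longrightarrow> j g = j h \<longleftrightarrow> eventually (\<lambda>i. g i = h i) U"
    and j_const: "j (\<lambda>_. a) = emb a"
    and inj_emb: "inj emb"
begin

text \<open>Values are required to lie in the sort at every index, not just eventually, so that
  evaluating a tuple at any index gives a well-sorted tuple of \<open>\<AA>\<close>.\<close>

definition hull :: "'s \<Rightarrow> ('i \<Rightarrow> 'a) set" where
  "hull \<sigma> = {g \<in> H. \<forall>i. g i \<in> dom_of \<AA> \<sigma>}"

abbreviation hull_tuple :: "('i \<Rightarrow> 'a) list \<Rightarrow> 's list \<Rightarrow> bool" where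
  "hull_tuple \<equiv> list_all2 (\<lambda>g \<sigma>. g \<in> hull \<sigma>)"

abbreviation pointwise :: "'f \<Rightarrow> ('i \<Rightarrow> 'a) list \<Rightarrow> 'i \<Rightarrow> 'a" where
  "pointwise f gs \<equiv> \<lambda>i. fun_of \<AA> f (map (\<lambda>g. g i) gs)"

text \<open>Functions act on chosen representatives, and predicates ask for some representatives.
  Since \<open>j\<close> identifies only functions that are eventually equal, neither depends on the
  choice.\<close>

definition \<BB> :: "('s, 'f, 'p, 'b) struct" where
  "\<BB> = \<lparr>dom_of = (\<lambda>\<sigma>. j ` hull \<sigma>),
     fun_of = (\<lambda>f ys. j (pointwise f
       (SOME gs. hull_tuple gs (fst (fun_arity \<Sigma> f)) \<and> map j gs = ys))),
     pred_of = (\<lambda>p. {map j gs | gs. hull_tuple gs (pred_arity \<Sigma> p) \<and>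
       eventually (\<lambda>i. map (\<lambda>g. g i) gs \<in> pred_of \<AA> p) U})\<rparr>"

section \<open>Well-definedness of the quotient structure\<close>

lemma hull_subset: "hull \<sigma> \<subseteq> H"
  by (auto simp: hull_def)

lemma hull_tuple_H: "hull_tuple gs \<sigma>s \<Longrightarrow> set gs \<subseteq> H"
  using hull_subset by (fastforce simp: list_all2_conv_all_nth in_set_conv_nth)

lemma hull_tuple_nth: "hull_tuple gs \<sigma>s \<Longrightarrow> map (\<lambda>g. g i) gs \<in> tuples \<AA> \<sigma>s"
  by (auto simp: tuples_def list_all2_conv_all_nth hull_def)

text \<open>Finitely many eventual equalities hold simultaneously, so equality of classes lifts from
  entries to tuples.\<close>

lemma map_j_eq:
  "set gs \<subseteq> H \<Longrightarrow> set hs \<subseteq> H \<Longrightarrow> map j gs = map j hs \<Longrightarrow>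
    eventually (\<lambda>i. map (\<lambda>g. g i) gs = map (\<lambda>g. g i) hs) U"
proof (induction gs arbitrary: hs)
  case (Cons g gs)
  then obtain h hs' where hs: "hs = h # hs'" by (cases hs) auto
  have "eventually (\<lambda>i. g i = h i) U"
    using Cons.prems j_eq unfolding hs by simp
  moreover have "eventually (\<lambda>i. map (\<lambda>g. g i) gs = map (\<lambda>g. g i) hs') U"
    using Cons unfolding hs by simp
  ultimately show ?case unfolding hs by eventually_elim simp
qed simp

lemma dom_of_\<BB>: "dom_of \<BB> \<sigma> = j ` hull \<sigma>"
  by (simp add: \<BB>_def)

lemma tuples_\<BB>: "tuples \<BB> \<sigma>s = {map j gs | gs. hull_tuple gs \<sigma>s}"
proof -
  have "\<exists>gs. ys = map j gs \<and> hull_tuple gs \<sigma>s"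
    if "list_all2 (\<lambda>x \<sigma>. x \<in> j ` hull \<sigma>) ys \<sigma>s" for ys
    using that
  proof (induction rule: list_all2_induct)
    case (Cons y ys \<sigma> \<sigma>s)
    then obtain g gs where "y = j g" "g \<in> hull \<sigma>" "ys = map j gs" "hull_tuple gs \<sigma>s" by blast
    then have "y # ys = map j (g # gs) \<and> hull_tuple (g # gs) (\<sigma> # \<sigma>s)" by simp
    then show ?case by (rule exI)
  qed simp
  moreover have "list_all2 (\<lambda>x \<sigma>. x \<in> j ` hull \<sigma>) (map j gs) \<sigma>s" if "hull_tuple gs \<sigma>s" for gs
    using that by (auto simp: list_all2_conv_all_nth)
  ultimately show ?thesis unfolding tuples_def dom_of_\<BB> by blast
qed

lemma pointwise_hull:
  assumes f: "f \<in> funs \<Sigma>" and gs: "hull_tuple gs (fst (fun_arity \<Sigma> f))"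
  shows "pointwise f gs \<in> hull (snd (fun_arity \<Sigma> f))"
proof -
  have "pointwise f gs i \<in> dom_of \<AA> (snd (fun_arity \<Sigma> f))" for i
    using f struct hull_tuple_nth[OF gs, of i] unfolding is_struct_def by blast
  then show ?thesis
    using H_fun[OF f hull_tuple_H[OF gs]] by (simp add: hull_def)
qed

lemma fun_of_\<BB>:
  assumes f: "f \<in> funs \<Sigma>" and gs: "hull_tuple gs (fst (fun_arity \<Sigma> f))"
  shows "fun_of \<BB> f (map j gs) = j (pointwise f gs)"
proof -
  define hs where
    "hs = (SOME hs. hull_tuple hs (fst (fun_arity \<Sigma> f)) \<and> map j hs = map j gs)"
  have "\<exists>hs. hull_tuple hs (fst (fun_arity \<Sigma> f)) \<and> map j hs = map j gs"
    using gs by blast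
  from someI_ex[OF this, folded hs_def]
  have hs: "hull_tuple hs (fst (fun_arity \<Sigma> f))" "map j hs = map j gs" by simp_all
  have "eventually (\<lambda>i. map (\<lambda>g. g i) hs = map (\<lambda>g. g i) gs) U"
    by (rule map_j_eq[OF hull_tuple_H[OF hs(1)] hull_tuple_H[OF gs] hs(2)])
  then have "eventually (\<lambda>i. pointwise f hs i = pointwise f gs i) U"
    by eventually_elim simp
  then have "j (pointwise f hs) = j (pointwise f gs)"
    using j_eq pointwise_hull[OF f hs(1)] pointwise_hull[OF f gs] hull_subset by blast
  then show ?thesis by (simp add: \<BB>_def hs_def)
qed

lemma pred_of_\<BB>:
  assumes "hull_tuple gs (pred_arity \<Sigma> p)"
  shows "map j gs \<in> pred_of \<BB> p \<longleftrightarrow> eventually (\<lambda>i. map (\<lambda>g. g i) gs \<in> pred_of \<AA> p) U"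
proof
  assume "map j gs \<in> pred_of \<BB> p"
  then obtain hs where hs: "map j gs = map j hs" "hull_tuple hs (pred_arity \<Sigma> p)"
    "eventually (\<lambda>i. map (\<lambda>g. g i) hs \<in> pred_of \<AA> p) U"
    by (auto simp: \<BB>_def)
  have "eventually (\<lambda>i. map (\<lambda>g. g i) gs = map (\<lambda>g. g i) hs) U"
    by (rule map_j_eq[OF hull_tuple_H[OF assms] hull_tuple_H[OF hs(2)] hs(1)])
  with hs(3) show "eventually (\<lambda>i. map (\<lambda>g. g i) gs \<in> pred_of \<AA> p) U"
    by eventually_elim simp
qed (use assms in \<open>auto simp: \<BB>_def\<close>)

lemma const_hull: "\<sigma> \<in> sorts \<Sigma> \<Longrightarrow> a \<in> dom_of \<AA> \<sigma> \<Longrightarrow> (\<lambda>_. a) \<in> hull \<sigma>"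
  by (simp add: hull_def H_const)

lemma is_struct_\<BB>: "is_struct \<Sigma> \<BB>"
  unfolding is_struct_def
proof (intro conjI ballI)
  fix \<sigma> assume \<sigma>: "\<sigma> \<in> sorts \<Sigma>"
  then have "dom_of \<AA> \<sigma> \<noteq> {}" using struct by (simp add: is_struct_def)
  then obtain a where "a \<in> dom_of \<AA> \<sigma>" by blast
  from const_hull[OF \<sigma> this] show "dom_of \<BB> \<sigma> \<noteq> {}" by (auto simp: dom_of_\<BB>)
  have eq: "pred_of \<AA> (eq_sym \<Sigma> \<sigma>) = {[x, x] | x. x \<in> dom_of \<AA> \<sigma>}"
    using struct \<sigma> by (simp add: is_struct_def)
  have ar: "pred_arity \<Sigma> (eq_sym \<Sigma> \<sigma>) = [\<sigma>, \<sigma>]"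
    using sig \<sigma> by (simp add: is_signature_def)
  show "pred_of \<BB> (eq_sym \<Sigma> \<sigma>) = {[y, y] | y. y \<in> dom_of \<BB> \<sigma>}"
  proof (intro equalityI subsetI)
    fix ys assume "ys \<in> pred_of \<BB> (eq_sym \<Sigma> \<sigma>)"
    then obtain g h where gh: "ys = [j g, j h]" "g \<in> hull \<sigma>" "h \<in> hull \<sigma>"
      and "eventually (\<lambda>i. [g i, h i] \<in> pred_of \<AA> (eq_sym \<Sigma> \<sigma>)) U"
      by (auto simp: \<BB>_def ar list_all2_Cons2)
    \<comment> \<open>Equality in \<open>\<AA>\<close> is genuine, so the equality symbol expresses
      eventual equality, which \<open>j\<close> turns into identity.\<close>
    from this(4) have "eventually (\<lambda>i. g i = h i) U"
      by eventually_elim (auto simp: eq)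
    then have "j g = j h" using gh hull_subset j_eq by blast
    then show "ys \<in> {[y, y] | y. y \<in> dom_of \<BB> \<sigma>}" using gh by (auto simp: dom_of_\<BB>)
  next
    fix ys assume "ys \<in> {[y, y] | y. y \<in> dom_of \<BB> \<sigma>}"
    then obtain g where g: "ys = map j [g, g]" "g \<in> hull \<sigma>" by (auto simp: dom_of_\<BB>)
    then show "ys \<in> pred_of \<BB> (eq_sym \<Sigma> \<sigma>)"
      unfolding g(1) by (subst pred_of_\<BB>) (auto simp: ar eq hull_def)
  qed
next
  fix f ys assume f: "f \<in> funs \<Sigma>" and "ys \<in> tuples \<BB> (fst (fun_arity \<Sigma> f))"
  then obtain gs where gs: "ys = map j gs" "hull_tuple gs (fst (fun_arity \<Sigma> f))"
    by (auto simp: tuples_\<BB>)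
  then show "fun_of \<BB> f ys \<in> dom_of \<BB> (snd (fun_arity \<Sigma> f))"
    using fun_of_\<BB>[OF f gs(2)] pointwise_hull[OF f gs(2)] by (simp add: dom_of_\<BB>)
next
  fix p assume "p \<in> preds \<Sigma>"
  show "pred_of \<BB> p \<subseteq> tuples \<BB> (pred_arity \<Sigma> p)"
    unfolding tuples_\<BB> by (auto simp: \<BB>_def)
qed

section \<open>Los's theorem for the hull\<close>

definition hull_assignment :: "(nat \<times> 's \<Rightarrow> 'i \<Rightarrow> 'a) \<Rightarrow> bool" where
  "hull_assignment \<nu> \<longleftrightarrow> (\<forall>v. snd v \<in> sorts \<Sigma> \<longrightarrow> \<nu> v \<in> hull (snd v))"

text \<open>Both claims go through one induction, because \<open>fun_of_\<BB>\<close> applies only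
  to arguments already known to lie in the hull.\<close>

lemma eval_tm_\<BB>:
  assumes "has_sort \<Sigma> t \<sigma>" "hull_assignment \<nu>"
  shows "(\<lambda>i. eval_tm \<AA> (\<lambda>v. \<nu> v i) t) \<in> hull \<sigma> \<and>
    eval_tm \<BB> (\<lambda>v. j (\<nu> v)) t = j (\<lambda>i. eval_tm \<AA> (\<lambda>v. \<nu> v i) t)"
  using assms(1)
proof (induction rule: has_sort.induct)
  case (1 \<sigma> n)
  then show ?case using assms(2) by (simp add: hull_assignment_def)
next
  case (2 f ts)
  let ?gs = "map (\<lambda>t i. eval_tm \<AA> (\<lambda>v. \<nu> v i) t) ts"
  have gs: "hull_tuple ?gs (fst (fun_arity \<Sigma> f))"
    using 2(2) by (auto simp: list_all2_conv_all_nth)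
  have "map (eval_tm \<BB> (\<lambda>v. j (\<nu> v))) ts = map j ?gs"
    using 2(2) by (auto simp: list_all2_conv_all_nth in_set_conv_nth)
  then have "eval_tm \<BB> (\<lambda>v. j (\<nu> v)) (App f ts) = j (pointwise f ?gs)"
    using fun_of_\<BB>[OF 2(1) gs] by (simp only: eval_tm.simps)
  then show ?case
    using pointwise_hull[OF 2(1) gs] by (simp add: comp_def)
qed

text \<open>Here Skolem closure enters: the pointwise Skolem function is a single member of
  \<open>H\<close> that supplies a witness at every index having one. Conversely, the values of
  \<open>g\<close> are themselves witnesses.\<close>

lemma eventually_Ex_iff:
  assumes \<phi>: "is_formula \<Sigma> \<phi>" and v: "snd v \<in> sorts \<Sigma>" and \<nu>: "hull_assignment \<nu>"
  shows "(\<exists>g\<in>hull (snd v). eventually (\<lambda>i. sat \<AA> (\<lambda>u. (\<nu>(v := g)) u i) \<phi>) U) \<longleftrightarrow>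
    eventually (\<lambda>i. \<exists>x\<in>dom_of \<AA> (snd v). sat \<AA> ((\<lambda>u. \<nu> u i)(v := x)) \<phi>) U" (is "?L \<longleftrightarrow> ?R")
proof -
  have upd: "(\<lambda>u. (\<nu>(v := g)) u i) = (\<lambda>u. \<nu> u i)(v := g i)" for g i by auto
  show ?thesis
  proof
    assume ?L
    then obtain g where g: "g \<in> hull (snd v)"
      and ev: "eventually (\<lambda>i. sat \<AA> ((\<lambda>u. \<nu> u i)(v := g i)) \<phi>) U"
      unfolding upd by blast
    from ev show ?R by eventually_elim (use g in \<open>auto simp: hull_def\<close>)
  next
    assume R: ?R
    let ?g = "\<lambda>i. skolem \<AA> \<phi> v (\<lambda>u. \<nu> u i)"
    have ne: "dom_of \<AA> (snd v) \<noteq> {}" using struct v by (simp add: is_struct_def)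
    \<comment> \<open>The variables of a formula have sorts of the signature, so
      \<open>\<nu>\<close> sends them into the hull and thus into \<open>H\<close>.\<close>
    have "?g \<in> H"
      using \<nu> is_formula_vars_fm[OF \<phi>] hull_subset unfolding hull_assignment_def
      by (intro H_skolem[OF \<phi> v]) blast
    then have "?g \<in> hull (snd v)"
      using skolem(1)[OF ne] by (simp add: hull_def)
    moreover from R have "eventually (\<lambda>i. sat \<AA> ((\<lambda>u. \<nu> u i)(v := ?g i)) \<phi>) U"
      by eventually_elim (use skolem(2)[OF ne] in blast)
    ultimately show ?L unfolding upd by (intro bexI[of _ ?g])
  qed
qed

lemma hull_assignment_upd:
  "hull_assignment \<nu> \<Longrightarrow> g \<in> hull (snd v) \<Longrightarrow> hull_assignment (\<nu>(v := g))"
  unfolding hull_assignment_def by (simp del: split_paired_All)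

theorem los:
  assumes "is_formula \<Sigma> \<phi>" "hull_assignment \<nu>"
  shows "sat \<BB> (\<lambda>v. j (\<nu> v)) \<phi> \<longleftrightarrow> eventually (\<lambda>i. sat \<AA> (\<lambda>v. \<nu> v i) \<phi>) U"
  using assms
proof (induction \<phi> arbitrary: \<nu>)
  case (Atom p ts)
  let ?gs = "map (\<lambda>t i. eval_tm \<AA> (\<lambda>v. \<nu> v i) t) ts"
  have ts: "list_all2 (has_sort \<Sigma>) ts (pred_arity \<Sigma> p)" using Atom by simp
  have gs: "hull_tuple ?gs (pred_arity \<Sigma> p)"
    using ts eval_tm_\<BB>[OF _ Atom.prems(2)] by (auto simp: list_all2_conv_all_nth)
  have "map (eval_tm \<BB> (\<lambda>v. j (\<nu> v))) ts = map j ?gs"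
    using ts eval_tm_\<BB>[OF _ Atom.prems(2)]
    by (fastforce simp: list_all2_conv_all_nth in_set_conv_nth)
  then have "sat \<BB> (\<lambda>v. j (\<nu> v)) (Atom p ts) \<longleftrightarrow> map j ?gs \<in> pred_of \<BB> p"
    by (simp only: sat.simps)
  also have "\<dots> \<longleftrightarrow> eventually (\<lambda>i. map (\<lambda>g. g i) ?gs \<in> pred_of \<AA> p) U"
    by (rule pred_of_\<BB>[OF gs])
  finally show ?case by (simp add: comp_def)
next
  case (Neg \<phi>)
  then show ?case by (simp flip: ultra_not_eventually[OF ultra])
next
  case (Conj \<phi> \<psi>)
  then show ?case by (simp add: eventually_conj_iff)
next
  case (Disj \<phi> \<psi>)
  then show ?case by (simp add: ultra_eventually_disj[OF ultra])
next
  case (Impl \<phi> \<psi>)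
  have "eventually (\<lambda>i. sat \<AA> (\<lambda>v. \<nu> v i) (Impl \<phi> \<psi>)) U \<longleftrightarrow>
      \<not> eventually (\<lambda>i. sat \<AA> (\<lambda>v. \<nu> v i) \<phi>) U \<or> eventually (\<lambda>i. sat \<AA> (\<lambda>v. \<nu> v i) \<psi>) U"
    unfolding sat.simps imp_conv_disj ultra_eventually_disj[OF ultra]
      ultra_not_eventually[OF ultra] ..
  then show ?case using Impl by simp
next
  case (Forall v \<phi>)
  have upd: "(\<lambda>u. j (\<nu> u))(v := j g) = (\<lambda>u. j ((\<nu>(v := g)) u))" for g by auto
  \<comment> \<open>The universal quantifier is treated as a negated existential one, so the Skolem
    functions used here are those of \<open>Neg \<phi>\<close>.\<close>
  have "\<not> sat \<BB> (\<lambda>u. j (\<nu> u)) (Forall v \<phi>)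
      \<longleftrightarrow> (\<exists>g\<in>hull (snd v). \<not> eventually (\<lambda>i. sat \<AA> (\<lambda>u. (\<nu>(v := g)) u i) \<phi>) U)"
    using Forall by (simp add: dom_of_\<BB> upd hull_assignment_upd del: fun_upd_apply)
  also have "\<dots> \<longleftrightarrow> (\<exists>g\<in>hull (snd v). eventually (\<lambda>i. sat \<AA> (\<lambda>u. (\<nu>(v := g)) u i) (Neg \<phi>)) U)"
    by (simp flip: ultra_not_eventually[OF ultra] del: fun_upd_apply)
  also have "\<dots> \<longleftrightarrow>
      eventually (\<lambda>i. \<exists>x\<in>dom_of \<AA> (snd v). sat \<AA> ((\<lambda>u. \<nu> u i)(v := x)) (Neg \<phi>)) U"
    using Forall.prems by (intro eventually_Ex_iff) simp_all
  also have "\<dots> \<longleftrightarrow> \<not> eventually (\<lambda>i. sat \<AA> (\<lambda>u. \<nu> u i) (Forall v \<phi>)) U"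
    unfolding ultra_not_eventually[OF ultra] by simp
  finally show ?case by blast
next
  case (Exists v \<phi>)
  have upd: "(\<lambda>u. j (\<nu> u))(v := j g) = (\<lambda>u. j ((\<nu>(v := g)) u))" for g by auto
  have "sat \<BB> (\<lambda>u. j (\<nu> u)) (Exists v \<phi>)
      \<longleftrightarrow> (\<exists>g\<in>hull (snd v). eventually (\<lambda>i. sat \<AA> (\<lambda>u. (\<nu>(v := g)) u i) \<phi>) U)"
    using Exists by (simp add: dom_of_\<BB> upd hull_assignment_upd del: fun_upd_apply)
  also have "\<dots> \<longleftrightarrow> eventually (\<lambda>i. sat \<AA> (\<lambda>u. \<nu> u i) (Exists v \<phi>)) U"
    using Exists.prems by (subst eventually_Ex_iff) simp_all
  finally show ?case .
qed

section \<open>The constants as an elementary substructure\<close>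

lemma const_tuple:
  assumes "set \<sigma>s \<subseteq> sorts \<Sigma>" "xs \<in> tuples \<AA> \<sigma>s"
  shows "hull_tuple (map (\<lambda>a _. a) xs) \<sigma>s" and "map j (map (\<lambda>a _. a) xs) = map emb xs"
proof -
  have *: "xs ! n \<in> dom_of \<AA> (\<sigma>s ! n) \<and> \<sigma>s ! n \<in> sorts \<Sigma>" if "n < length xs" for n
    using that assms by (auto simp: tuples_def list_all2_conv_all_nth)
  show "hull_tuple (map (\<lambda>a _. a) xs) \<sigma>s"
    using assms(2) * const_hull by (auto simp: tuples_def list_all2_conv_all_nth)
  show "map j (map (\<lambda>a _. a) xs) = map emb xs"
    using * j_const by (intro nth_equalityI) auto
qed

lemma substruct_\<BB>: "substruct \<Sigma> (image_struct emb \<AA>) \<BB>"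
  unfolding substruct_def
proof (intro conjI ballI)
  show "is_struct \<Sigma> (image_struct emb \<AA>)"
    by (rule is_struct_image_struct[OF inj_emb struct])
  show "is_struct \<Sigma> \<BB>" by (rule is_struct_\<BB>)
next
  fix \<sigma> assume "\<sigma> \<in> sorts \<Sigma>"
  then show "dom_of (image_struct emb \<AA>) \<sigma> \<subseteq> dom_of \<BB> \<sigma>"
    using const_hull by (auto simp: dom_of_\<BB> simp flip: j_const)
next
  fix f ys
  assume f: "f \<in> funs \<Sigma>" and "ys \<in> tuples (image_struct emb \<AA>) (fst (fun_arity \<Sigma> f))"
  then obtain xs where xs: "xs \<in> tuples \<AA> (fst (fun_arity \<Sigma> f))" and ys: "ys = map emb xs"
    unfolding tuples_image_struct by blast
  have s: "set (fst (fun_arity \<Sigma> f)) \<subseteq> sorts \<Sigma>"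
    using sig f by (auto simp: is_signature_def)
  have "fun_of \<BB> f ys = j (pointwise f (map (\<lambda>a _. a) xs))"
    using fun_of_\<BB>[OF f const_tuple(1)[OF s xs]]
    unfolding const_tuple(2)[OF s xs] ys .
  also have "\<dots> = emb (fun_of \<AA> f xs)"
    using j_const by (simp add: comp_def)
  finally show "fun_of (image_struct emb \<AA>) f ys = fun_of \<BB> f ys"
    unfolding ys fun_of_image_struct[OF inj_emb] ..
next
  fix p assume p: "p \<in> preds \<Sigma>"
  have s: "set (pred_arity \<Sigma> p) \<subseteq> sorts \<Sigma>" using sig p by (auto simp: is_signature_def)
  \<comment> \<open>On constant functions the condition does not depend on the index, and in a
    proper filter such a condition holds eventually iff it is true.\<close>
  have *: "map emb xs \<in> pred_of \<BB> p \<longleftrightarrow> xs \<in> pred_of \<AA> p"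
    if xs: "xs \<in> tuples \<AA> (pred_arity \<Sigma> p)" for xs
    using pred_of_\<BB>[OF const_tuple(1)[OF s xs]] ultra
    unfolding const_tuple(2)[OF s xs] by (simp add: comp_def eventually_const ultra_def)
  have sub: "pred_of \<AA> p \<subseteq> tuples \<AA> (pred_arity \<Sigma> p)"
    using struct p by (simp add: is_struct_def)
  show "pred_of (image_struct emb \<AA>) p
      = pred_of \<BB> p \<inter> tuples (image_struct emb \<AA>) (pred_arity \<Sigma> p)"
    unfolding tuples_image_struct pred_of_image_struct using * sub by blast
qed

text \<open>This is Los's theorem for constant functions, where truth at almost all indices is truth
  in \<open>\<AA>\<close>.\<close>

theorem elementary_substruct_\<BB>: "elementary_substruct \<Sigma> (image_struct emb \<AA>) \<BB>"
  unfolding elementary_substruct_def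
proof (intro conjI substruct_\<BB> allI impI)
  fix \<phi> \<nu> assume \<phi>: "is_formula \<Sigma> \<phi>" and \<nu>: "is_assignment \<Sigma> (image_struct emb \<AA>) \<nu>"
  \<comment> \<open>The assignment is pulled back along \<open>emb\<close>. At variables of foreign
    sorts this may fail to invert, so \<open>\<nu>\<close> is replaced only on the variables of
    \<open>\<phi>\<close>.\<close>
  define \<mu> where "\<mu> v = inv emb (\<nu> v)" for v
  have \<mu>: "\<mu> v \<in> dom_of \<AA> (snd v)" "\<nu> v = emb (\<mu> v)" if "snd v \<in> sorts \<Sigma>" for v
  proof -
    have "\<nu> v \<in> emb ` dom_of \<AA> (snd v)"
      using \<nu> that by (cases v) (simp add: is_assignment_def)
    then show "\<mu> v \<in> dom_of \<AA> (snd v)" "\<nu> v = emb (\<mu> v)"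
      using inj_emb by (auto simp: \<mu>_def)
  qed
  have "sat (image_struct emb \<AA>) \<nu> \<phi> \<longleftrightarrow> sat (image_struct emb \<AA>) (\<lambda>v. emb (\<mu> v)) \<phi>"
    using \<mu>(2) is_formula_vars_fm[OF \<phi>] by (intro sat_cong) blast
  also have "\<dots> \<longleftrightarrow> eventually (\<lambda>i. sat \<AA> \<mu> \<phi>) U"
    using ultra by (simp add: sat_image_struct[OF inj_emb] ultra_def eventually_const)
  also have "\<dots> \<longleftrightarrow> sat \<BB> (\<lambda>v. j (\<lambda>_. \<mu> v)) \<phi>"
    using \<mu>(1) const_hull by (intro los[symmetric] \<phi>) (simp add: hull_assignment_def)
  also have "\<dots> \<longleftrightarrow> sat \<BB> \<nu> \<phi>"
    using \<mu> is_formula_vars_fm[OF \<phi>] j_const by (intro sat_cong) metis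
  finally show "sat (image_struct emb \<AA>) \<nu> \<phi> \<longleftrightarrow> sat \<BB> \<nu> \<phi>" .
qed

lemma dom_of_\<BB>_finite:
  assumes "\<sigma> \<in> sorts \<Sigma>" "finite (dom_of \<AA> \<sigma>)"
  shows "dom_of \<BB> \<sigma> = emb ` dom_of \<AA> \<sigma>"
proof
  show "emb ` dom_of \<AA> \<sigma> \<subseteq> dom_of \<BB> \<sigma>"
    using substruct_\<BB> assms(1) by (simp add: substruct_def)
  show "dom_of \<BB> \<sigma> \<subseteq> emb ` dom_of \<AA> \<sigma>"
  proof
    fix y assume "y \<in> dom_of \<BB> \<sigma>"
    then obtain g where g: "y = j g" "g \<in> hull \<sigma>" by (auto simp: dom_of_\<BB>)
    then have "eventually (\<lambda>i. g i \<in> dom_of \<AA> \<sigma>) U" by (simp add: hull_def)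
    from ultra_eventually_finite[OF ultra assms(2) this]
    obtain a where a: "a \<in> dom_of \<AA> \<sigma>" "eventually (\<lambda>i. g i = a) U" .
    then have "j g = j (\<lambda>_. a)"
      using j_eq g(2) H_const[OF assms(1) a(1)] hull_subset by blast
    then show "y \<in> emb ` dom_of \<AA> \<sigma>" using g(1) j_const a(1) by simp
  qed
qed

end

section \<open>A small Skolem-closed set with many classes\<close>

text \<open>\<open>E\<close> is closed under one operation for each function symbol and one for each
  pair of a formula and a variable; there are at most \<open>r\<close> such operations.\<close>

lemma exists_skolem_closed:
  fixes \<Sigma> :: "('s, 'f, 'p) signature" and \<AA> :: "('s, 'f, 'p, 'a) struct"
    and r :: "'k rel" and E :: "('i \<Rightarrow> 'a) set"
  assumes r: "Card_order r" and inf: "infinite (Field r)"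
    and sorts: "|sorts \<Sigma>| \<le>o r" and funs: "|funs \<Sigma>| \<le>o r" and preds: "|preds \<Sigma>| \<le>o r"
    and E: "|E| \<le>o r"
  obtains H where "E \<subseteq> H" "|H| \<le>o r"
    "\<And>f gs. f \<in> funs \<Sigma> \<Longrightarrow> set gs \<subseteq> H \<Longrightarrow> (\<lambda>i. fun_of \<AA> f (map (\<lambda>g. g i) gs)) \<in> H"
    "\<And>\<phi> v \<nu>. is_formula \<Sigma> \<phi> \<Longrightarrow> snd v \<in> sorts \<Sigma> \<Longrightarrow>
      (\<And>u. u \<in> vars_fm \<phi> \<Longrightarrow> \<nu> u \<in> H) \<Longrightarrow> (\<lambda>i. skolem \<AA> \<phi> v (\<lambda>u. \<nu> u i)) \<in> H"
proof -
  \<comment> \<open>Listing the variables of \<open>\<phi>\<close> turns its Skolem function, which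
    takes an assignment, into an operation on lists of functions.\<close>
  define vl :: "('s, 'f, 'p) fm \<Rightarrow> (nat \<times> 's) list" where
    "vl \<phi> = (SOME vs. set vs = vars_fm \<phi>)" for \<phi>
  have vl: "set (vl \<phi>) = vars_fm \<phi>" for \<phi>
    unfolding vl_def using finite_list[OF finite_vars_fm] by (rule someI_ex)
  define sk :: "('s, 'f, 'p) fm \<times> (nat \<times> 's) \<Rightarrow> ('i \<Rightarrow> 'a) list \<Rightarrow> 'i \<Rightarrow> 'a" where
    \<comment> \<open>The lookup rebuilds an assignment from the list. Off the variables of
      \<open>\<phi>\<close> its value is unspecified, which \<open>skolem_cong\<close> shows to be
      harmless.\<close>
    "sk = (\<lambda>(\<phi>, v) gs i. skolem \<AA> \<phi> v (\<lambda>u. the (map_of (zip (vl \<phi>) gs) u) i))"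
  define F where "F = (\<lambda>f gs i. fun_of \<AA> f (map (\<lambda>g. g i) gs)) ` funs \<Sigma>
    \<union> sk ` ({\<phi>. is_formula \<Sigma> \<phi>} \<times> (UNIV \<times> sorts \<Sigma>))"
  have F: "|F| \<le>o r"
    unfolding F_def
    by (intro card_of_Un_ordLeq_infinite_Field card_of_image_ordLeq
        card_of_Times_ordLeq_infinite_Field[OF inf _ _ r]
        card_of_formulas_ordLeq card_of_nat_ordLeq r inf sorts funs preds)
  show thesis
  proof (rule that[of "op_closure F E"])
    show "E \<subseteq> op_closure F E" by (auto intro: op_closure.base)
    show "|op_closure F E| \<le>o r" by (rule card_of_op_closure_ordLeq[OF r inf F E])
    show "(\<lambda>i. fun_of \<AA> f (map (\<lambda>g. g i) gs)) \<in> op_closure F E"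
      if "f \<in> funs \<Sigma>" "set gs \<subseteq> op_closure F E" for f gs
    proof -
      have "(\<lambda>gs i. fun_of \<AA> f (map (\<lambda>g. g i) gs)) \<in> F" using that(1) by (auto simp: F_def)
      from op_closure.op[OF this, of gs] show ?thesis using that(2) by blast
    qed
    show "(\<lambda>i. skolem \<AA> \<phi> v (\<lambda>u. \<nu> u i)) \<in> op_closure F E"
      if "is_formula \<Sigma> \<phi>" "snd v \<in> sorts \<Sigma>" "\<And>u. u \<in> vars_fm \<phi> \<Longrightarrow> \<nu> u \<in> op_closure F E" for \<phi> v \<nu>
    proof -
      have "sk (\<phi>, v) \<in> F" using that(1,2) by (cases v) (auto simp: F_def)
      then have "sk (\<phi>, v) (map \<nu> (vl \<phi>)) \<in> op_closure F E"
        using that(3) by (intro op_closure.op) (auto simp: vl)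
      moreover have "sk (\<phi>, v) (map \<nu> (vl \<phi>)) = (\<lambda>i. skolem \<AA> \<phi> v (\<lambda>u. \<nu> u i))"
        unfolding sk_def by (auto simp: map_of_zip_map vl intro!: skolem_cong)
      ultimately show ?thesis by simp
    qed
  qed
qed

text \<open>For finite index sets \<open>J\<close> each \<open>d J\<close> is injective on \<open>J\<close>, so the functions
  \<open>\<lambda>J. d J k\<close> with \<open>k \<in> K\<close> differ pairwise at all large \<open>J\<close>.\<close>

lemma exists_eventually_distinct_family:
  assumes "infinite D"
  obtains e :: "'k \<Rightarrow> 'k set \<Rightarrow> 'a"
  where "\<And>k J. e k J \<in> D"
    "\<And>k l. k \<in> K \<Longrightarrow> l \<in> K \<Longrightarrow> k \<noteq> l \<Longrightarrow> eventually (\<lambda>J. e k J \<noteq> e l J) (finite_subsets_at_top K)"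
proof -
  have "\<exists>d :: 'k \<Rightarrow> 'a. range d \<subseteq> D \<and> (finite J \<longrightarrow> inj_on d J)" for J
  proof (cases "finite J")
    case True
    \<comment> \<open>An infinite set has a subset of the same finite size as \<open>J\<close>,
      although it may be far too small to receive all of \<open>K\<close> injectively.\<close>
    obtain D' where D': "D' \<subseteq> D" "finite D'" "card D' = card J"
      using infinite_arbitrarily_large[OF assms] by blast
    then obtain d where d: "bij_betw d J D'"
      using True finite_same_card_bij by metis
    obtain a where a: "a \<in> D" using assms by fastforce
    let ?d = "\<lambda>k. if k \<in> J then d k else a"
    have "range ?d \<subseteq> D" using d D'(1) a by (auto simp: bij_betw_def)
    moreover have "inj_on ?d J" using d by (auto simp: bij_betw_def inj_on_def)
    ultimately show ?thesis by blast
  next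
    case False
    obtain a where "a \<in> D" using assms by fastforce
    with False show ?thesis by (intro exI[of _ "\<lambda>_. a"]) auto
  qed
  then obtain d :: "'k set \<Rightarrow> 'k \<Rightarrow> 'a"
    where d: "\<And>J. range (d J) \<subseteq> D" "\<And>J. finite J \<Longrightarrow> inj_on (d J) J" by metis
  show thesis
  proof (rule that[of "\<lambda>k J. d J k"])
    show "d J k \<in> D" for k J using d(1) by blast
    \<comment> \<open>The finite set \<open>{k, l}\<close> is the threshold: every finite
      \<open>J\<close> above it contains both points, and \<open>d J\<close> separates them.\<close>
    show "eventually (\<lambda>J. d J k \<noteq> d J l) (finite_subsets_at_top K)"
      if "k \<in> K" "l \<in> K" "k \<noteq> l" for k l
      unfolding eventually_finite_subsets_at_top
      using that d(2) by (intro exI[of _ "{k, l}"]) (auto dest: inj_onD)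
  qed
qed

text \<open>A class containing a constant goes to \<open>Inl\<close> of that constant, which is
  unique as \<open>U\<close> is proper. Any other class goes to \<open>Inr\<close> of a code of a
  representative in \<open>H\<close>; codes in \<open>'k\<close> exist by the bound on
  \<open>H\<close>.\<close>

lemma exists_quotient_map:
  fixes U :: "'i filter" and H :: "('i \<Rightarrow> 'a) set" and r :: "'k rel"
  assumes U: "U \<noteq> bot" and r: "Card_order r" and H: "|H| \<le>o r"
  obtains j :: "('i \<Rightarrow> 'a) \<Rightarrow> 'a + 'k"
  where "\<And>g h. g \<in> H \<Longrightarrow> h \<in> H \<Longrightarrow> j g = j h \<longleftrightarrow> eventually (\<lambda>i. g i = h i) U"
    "\<And>a. j (\<lambda>_. a) = Inl a"
proof -
  define eqv where "eqv g h \<longleftrightarrow> eventually (\<lambda>i. g i = h i) U" for g h :: "'i \<Rightarrow> 'a"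
  have refl: "eqv g g" for g by (simp add: eqv_def)
  have sym: "eqv g h \<Longrightarrow> eqv h g" for g h by (simp add: eqv_def eq_commute)
  have trans: "eqv g k" if "eqv g h" "eqv h k" for g h k
    using that unfolding eqv_def by eventually_elim simp
  have const: "eqv (\<lambda>_. a) (\<lambda>_. b) \<longleftrightarrow> a = b" for a b
    using U by (simp add: eqv_def eventually_const)
  obtain m :: "('i \<Rightarrow> 'a) \<Rightarrow> 'k" where m: "inj_on m H"
    using H card_of_Field_ordIso[OF r] card_of_ordLeq
    by (metis ordIso_symmetric ordLeq_ordIso_trans)
  define rep where "rep g = (SOME h. h \<in> H \<and> eqv g h)" for g
  have rep: "rep g \<in> H" "eqv g (rep g)" if "g \<in> H" for g
    using someI_ex[of "\<lambda>h. h \<in> H \<and> eqv g h"] that refl unfolding rep_def by blast+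
  \<comment> \<open>Equivalent functions define the same predicate, so the choice operator returns
    the same representative.\<close>
  have rep_eq: "rep g = rep h" if "eqv g h" for g h
  proof -
    have "eqv g k \<longleftrightarrow> eqv h k" for k using that sym trans by blast
    then show ?thesis by (simp add: rep_def)
  qed
  define j where
    "j g = (if \<exists>a. eqv g (\<lambda>_. a) then Inl (THE a. eqv g (\<lambda>_. a)) else Inr (m (rep g)))" for g
  have j_Inl: "j g = Inl a" if "eqv g (\<lambda>_. a)" for g a
  proof -
    have "(THE b. eqv g (\<lambda>_. b)) = a"
      using that const sym trans by (intro the_equality) blast+
    then show ?thesis using that by (auto simp: j_def)
  qed
  have j_Inr: "j g = Inr (m (rep g))" if "\<nexists>a. eqv g (\<lambda>_. a)" for g
    using that by (simp add: j_def)
  have "j g = j h \<longleftrightarrow> eqv g h" if gh: "g \<in> H" "h \<in> H" for g h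
  proof (cases "\<exists>a. eqv g (\<lambda>_. a)")
    case True
    then obtain a where a: "eqv g (\<lambda>_. a)" ..
    show ?thesis
    proof (cases "\<exists>b. eqv h (\<lambda>_. b)")
      case True
      then obtain b where b: "eqv h (\<lambda>_. b)" ..
      then show ?thesis using a j_Inl[OF a] j_Inl[OF b] const sym trans by (metis sum.inject(1))
    next
      case False
      then show ?thesis using a j_Inl[OF a] j_Inr[OF False] sym trans by (metis sum.distinct(1))
    qed
  next
    case g: False
    show ?thesis
    proof (cases "\<exists>b. eqv h (\<lambda>_. b)")
      case True
      then show ?thesis using g j_Inl j_Inr[OF g] trans by (metis sum.distinct(1))
    next
      case False
      have "j g = j h \<longleftrightarrow> rep g = rep h"
        using j_Inr[OF g] j_Inr[OF False] inj_on_eq_iff[OF m rep(1)[OF gh(1)] rep(1)[OF gh(2)]]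
        by simp
      also have "\<dots> \<longleftrightarrow> eqv g h" using rep_eq rep(2) gh sym trans by metis
      finally show ?thesis .
    qed
  qed
  moreover have "j (\<lambda>_. a) = Inl a" for a by (rule j_Inl) (rule refl)
  ultimately show thesis using that unfolding eqv_def by blast
qed

section \<open>Assembly of the extension of size \<open>\<kappa>\<close>\<close>

theorem theorem5:
  fixes \<Sigma> :: "('s, 'f, 'p) signature"
    and \<AA> :: "('s, 'f, 'p, 'a) struct"
    and \<kappa> :: "'k rel"
  assumes "is_signature \<Sigma>"
    and "finite (sorts \<Sigma>)"
    and "is_struct \<Sigma> \<AA>"
    and "\<exists>\<sigma>\<in>sorts \<Sigma>. natLeq \<le>o |dom_of \<AA> \<sigma>|"
    and "Card_order \<kappa>"
    and "sig_card \<Sigma> \<le>o \<kappa>"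
    and "\<forall>\<sigma>\<in>sorts \<Sigma>. |dom_of \<AA> \<sigma>| \<le>o \<kappa>"
  shows "\<exists>\<BB> :: ('s, 'f, 'p, 'a + 'k) struct.
    is_struct \<Sigma> \<BB> \<and>
    elementary_substruct \<Sigma> (image_struct Inl \<AA>) \<BB> \<and>
    (\<forall>\<sigma>\<in>fin_sorts \<Sigma> \<AA>. dom_of \<BB> \<sigma> = dom_of (image_struct Inl \<AA>) \<sigma>) \<and>
    (\<forall>\<sigma>\<in>inf_sorts \<Sigma> \<AA>. natLeq \<le>o |dom_of \<BB> \<sigma>| \<and> |dom_of \<BB> \<sigma>| \<le>o \<kappa>) \<and>
    (\<exists>\<sigma>\<in>sorts \<Sigma>. |dom_of \<BB> \<sigma>| =o \<kappa>)"
proof -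
  note sig = assms(1) and struct = assms(3) and \<kappa> = assms(5) and doms = assms(7)
  obtain \<sigma>0 where \<sigma>0: "\<sigma>0 \<in> sorts \<Sigma>" "natLeq \<le>o |dom_of \<AA> \<sigma>0|" using assms(4) by blast
  have D: "infinite (dom_of \<AA> \<sigma>0)" using \<sigma>0(2) infinite_iff_natLeq_ordLeq by blast
  have "|dom_of \<AA> \<sigma>0| \<le>o |Field \<kappa>|"
    using doms \<sigma>0(1) card_of_Field_ordIso[OF \<kappa>] ordIso_symmetric ordLeq_ordIso_trans by blast
  then have inf: "infinite (Field \<kappa>)" using D card_of_ordLeq_infinite by blast
  have sorts: "|sorts \<Sigma>| \<le>o \<kappa>" and funs: "|funs \<Sigma>| \<le>o \<kappa>" and preds: "|preds \<Sigma>| \<le>o \<kappa>"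
  proof -
    have sum: "|sorts \<Sigma> <+> (funs \<Sigma> <+> preds \<Sigma>)| \<le>o \<kappa>"
      using assms(6) by (simp add: sig_card_def csum_def Field_card_of)
    show "|sorts \<Sigma>| \<le>o \<kappa>" by (rule ordLeq_transitive[OF card_of_Plus1 sum])
    have *: "|funs \<Sigma> <+> preds \<Sigma>| \<le>o \<kappa>" by (rule ordLeq_transitive[OF card_of_Plus2 sum])
    show "|funs \<Sigma>| \<le>o \<kappa>" by (rule ordLeq_transitive[OF card_of_Plus1 *])
    show "|preds \<Sigma>| \<le>o \<kappa>" by (rule ordLeq_transitive[OF card_of_Plus2 *])
  qed
  obtain U where U: "ultra U" "U \<le> finite_subsets_at_top (Field \<kappa>)"
    using ultra_exists[OF finite_subsets_at_top_neq_bot] .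
  obtain e :: "'k \<Rightarrow> 'k set \<Rightarrow> 'a" where e: "\<And>k J. e k J \<in> dom_of \<AA> \<sigma>0"
    and "\<And>k l. k \<in> Field \<kappa> \<Longrightarrow> l \<in> Field \<kappa> \<Longrightarrow> k \<noteq> l \<Longrightarrow>
      eventually (\<lambda>J. e k J \<noteq> e l J) (finite_subsets_at_top (Field \<kappa>))"
    using exists_eventually_distinct_family[OF D] by blast
  \<comment> \<open>Distinctness at all large \<open>J\<close> passes to the finer filter
    \<open>U\<close>, where it excludes eventual equality.\<close>
  then have e_neq: "\<not> eventually (\<lambda>J. e k J = e l J) U"
    if "k \<in> Field \<kappa>" "l \<in> Field \<kappa>" "k \<noteq> l" for k l
    using that filter_leD[OF U(2)] unfolding ultra_not_eventually[OF U(1)] by blast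
  \<comment> \<open>The generators are the constants, at most \<open>\<kappa>\<close> many in each
    of at most \<open>\<kappa>\<close> sorts, and the \<open>\<kappa>\<close> functions that force a
    sort to be large.\<close>
  define E where "E = (\<lambda>a _. a) ` (\<Union>\<sigma>\<in>sorts \<Sigma>. dom_of \<AA> \<sigma>) \<union> e ` Field \<kappa>"
  have "|Field \<kappa>| \<le>o \<kappa>" using card_of_Field_ordIso[OF \<kappa>] ordIso_iff_ordLeq by blast
  then have "|E| \<le>o \<kappa>"
    unfolding E_def using doms
    by (intro card_of_Un_ordLeq_infinite_Field inf \<kappa> card_of_image_ordLeq
        card_of_UNION_ordLeq_infinite_Field sorts)
  from exists_skolem_closed[OF \<kappa> inf sorts funs preds this, of \<AA>] obtain H where
    E: "E \<subseteq> H" and H: "|H| \<le>o \<kappa>"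
    and H_fun: "\<And>f gs. f \<in> funs \<Sigma> \<Longrightarrow> set gs \<subseteq> H \<Longrightarrow> (\<lambda>i. fun_of \<AA> f (map (\<lambda>g. g i) gs)) \<in> H"
    and H_skolem: "\<And>\<phi> v \<nu>. is_formula \<Sigma> \<phi> \<Longrightarrow> snd v \<in> sorts \<Sigma> \<Longrightarrow>
      (\<And>u. u \<in> vars_fm \<phi> \<Longrightarrow> \<nu> u \<in> H) \<Longrightarrow> (\<lambda>i. skolem \<AA> \<phi> v (\<lambda>u. \<nu> u i)) \<in> H"
    by blast
  have "U \<noteq> bot" using U(1) by (simp add: ultra_def)
  then obtain j :: "('k set \<Rightarrow> 'a) \<Rightarrow> 'a + 'k" where
    j: "\<And>g h. g \<in> H \<Longrightarrow> h \<in> H \<Longrightarrow> j g = j h \<longleftrightarrow> eventually (\<lambda>i. g i = h i) U"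
    and j_const: "\<And>a. j (\<lambda>_. a) = Inl a"
    using exists_quotient_map[OF _ \<kappa> H] by blast
  interpret ultrapower_hull \<Sigma> \<AA> U H j Inl
  proof
    show "(\<lambda>_. a) \<in> H" if "\<sigma> \<in> sorts \<Sigma>" "a \<in> dom_of \<AA> \<sigma>" for \<sigma> a
      using that E unfolding E_def by blast
  qed (fact sig struct U(1) j j_const H_fun H_skolem inj_Inl[of UNIV])+
  \<comment> \<open>Every sort is the image under \<open>j\<close> of a part of \<open>H\<close>, so
    one bound serves all sorts.\<close>
  have upper: "|dom_of \<BB> \<sigma>| \<le>o \<kappa>" for \<sigma>
    unfolding dom_of_\<BB> by (intro card_of_image_ordLeq card_of_subset_ordLeq[OF hull_subset] H)
  show ?thesis
  proof (intro exI[of _ \<BB>] conjI ballI is_struct_\<BB> elementary_substruct_\<BB> upper)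
    show "dom_of \<BB> \<sigma> = dom_of (image_struct Inl \<AA>) \<sigma>" if "\<sigma> \<in> fin_sorts \<Sigma> \<AA>" for \<sigma>
      using that dom_of_\<BB>_finite infinite_iff_natLeq_ordLeq
      by (auto simp: fin_sorts_def inf_sorts_def)
  next
    fix \<sigma> assume "\<sigma> \<in> inf_sorts \<Sigma> \<AA>"
    then have \<sigma>: "\<sigma> \<in> sorts \<Sigma>" "infinite (dom_of \<AA> \<sigma>)"
      unfolding inf_sorts_def using infinite_iff_natLeq_ordLeq by blast+
    have "Inl ` dom_of \<AA> \<sigma> \<subseteq> dom_of \<BB> \<sigma>"
      using substruct_\<BB> \<sigma>(1) by (simp add: substruct_def)
    then have "infinite (dom_of \<BB> \<sigma>)"
      using \<sigma>(2) by (metis finite_imageD finite_subset inj_Inl)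
    then show "natLeq \<le>o |dom_of \<BB> \<sigma>|" using infinite_iff_natLeq_ordLeq by blast
  next
    \<comment> \<open>The size \<open>\<kappa>\<close> is attained in \<open>\<sigma>0\<close>: the
      functions \<open>e k\<close> take all their values there, and their classes are pairwise
      distinct.\<close>
    have eH: "e k \<in> hull \<sigma>0" if "k \<in> Field \<kappa>" for k
      using that e E by (auto simp: hull_def E_def)
    have "inj_on (\<lambda>k. j (e k)) (Field \<kappa>)"
      using j eH hull_subset e_neq by (intro inj_onI) blast
    moreover have "(\<lambda>k. j (e k)) ` Field \<kappa> \<subseteq> dom_of \<BB> \<sigma>0"
      using eH by (auto simp: dom_of_\<BB>)
    ultimately have "|Field \<kappa>| \<le>o |dom_of \<BB> \<sigma>0|" using card_of_ordLeq by blast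
    then have "\<kappa> \<le>o |dom_of \<BB> \<sigma>0|"
      using card_of_Field_ordIso[OF \<kappa>] ordIso_symmetric ordIso_ordLeq_trans by blast
    with upper[of \<sigma>0] \<sigma>0(1) show "\<exists>\<sigma>\<in>sorts \<Sigma>. |dom_of \<BB> \<sigma>| =o \<kappa>"
      using ordIso_iff_ordLeq by blast
  qed
qed

end
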